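(* Let $p$ be a polynomial with non-negative integer coefficients and let $\varphi_k(x)$, $k\ge r$, be defined by $\varphi_r(x)=1$ and $\varphi_k(x)=(x-[p(r)]_q)(x-[p(r+1)]_q)\cdots(x-[p(k-1)]_q)$ for $k>r$. The following are equivalent characterizations for the array $(S_{n,k,r}^{p(x)}(q))_{0\le r\le k\le n}$ (where for all other values of the triple $(n,k,r)$ we assume $S_{n,k,r}^{p(x)}(q)=0$): (1) (Defining equation/Change of bases) For each $n\ge r$: $$x^{n-r}=\sum_{k=r}^n S_{n,k,r}^{p(x)}(q)\,\varphi_k(x).$$ (2) (Recursion) For each $n\ge k>r$: $$S_{n,k,r}^{p(x)}(q)=S_{n-1,k-1,r}^{p(x)}(q)+[p(k)]_q\,S_{n-1,k,r}^{p(x)}(q),$$ with the boundary conditions $S_{r,r,r}^{p(x)}(q)=1$ and $S_{n,k,r}^{p(x)}(q)=0$ for $k<r$, $k>n$ or $n<r$. (3) (Complete recursion) For $n\ge k>r$: $$S_{n,k,r}^{p(x)}(q)=\sum_{j=k}^n S_{j-1,k-1,r}^{p(x)}(q)\,([p(k)]_q)^{n-j},$$ subject to the same boundary conditions as in condition (2). (4) (Ordinary generating function) For each $k\ge r$: $$\sum_{n=k}^\infty S_{n,k,r}^{p(x)}(q)\,x^n=\frac{x^k}{(1-[p(r)]_q x)\cdots(1-[p(k)]_q x)}.$$ (5) (Explicit formula) For $r\le k\le n$: $$S_{n,k,r}^{p(x)}(q)=\sum_{\substack{i_r+i_{r+1}+\cdots+i_k=n-k\\ i_l\ge 0}}([p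(r)]_q)^{i_r}\cdots([p(k)]_q)^{i_k}.$$
   Context: Here $[m]_q=1+q+\cdots+q^{m-1}=\frac{q^m-1}{q-1}$ is the $q$-analogue of $m$. For $p(x)\in\mathbb{Z}[x]$, the type II $q,r$-poly-Stirling numbers of the second kind $S_{n,k,r}^{p(x)}(q)$ are defined by the recurrence $S_{n,k,r}^{p(x)}(q)=S_{n-1,k-1,r}^{p(x)}(q)+[p(k)]_q S_{n-1,k,r}^{p(x)}(q)$ for $r\le k\le n$, $n>r$, with $S_{r,r,r}^{p(x)}(q)=1$ and $S_{n,k,r}^{p(x)}(q)=0$ for $k<r$, $k>n$ or $n<r$.
   Formalization: The boundary conditions in (2) and (3) also include S_{n,r,r} = [p(r)]_q S_{n-1,r,r} for n > r (the case k = r of the defining recurrence); as printed they leave the column k = r undetermined, so the equivalence fails. *)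

theory Defs
  imports
    "HOL-Library.FuncSet"
    "HOL-Computational_Algebra.Polynomial"
    "HOL-Computational_Algebra.Formal_Power_Series"
begin

definition q_num :: "'a::field \<Rightarrow> nat \<Rightarrow> 'a" where
  "q_num q m = (\<Sum>i<m. q ^ i)"

text \<open>
  The type II \<open>q,r\<close>-poly-Stirling numbers of the second kind. The inner conditional encodes
  \<open>S n (r - 1) r = 0\<close>; it cannot be left to truncated subtraction, since for \<open>r = 0\<close>
  the index \<open>k - 1 = -1\<close> would become \<open>0\<close>.
\<close>

fun qr_stirling2 :: "'a::field \<Rightarrow> nat poly \<Rightarrow> nat \<Rightarrow> nat \<Rightarrow> nat \<Rightarrow> 'a" where
  "qr_stirling2 q p n k r =
     (if k < r \<or> k > n \<or> n < r then 0
      else if n = r then 1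
      else (if k = r then 0 else qr_stirling2 q p (n - 1) (k - 1) r)
           + q_num q (poly p k) * qr_stirling2 q p (n - 1) k r)"

declare qr_stirling2.simps [simp del]

definition shifted_basis :: "'a::field \<Rightarrow> nat poly \<Rightarrow> nat \<Rightarrow> nat \<Rightarrow> 'a poly" where
  "shifted_basis q p r k = (\<Prod>i\<in>{r..<k}. [:- q_num q (poly p i), 1:])"

definition change_of_bases ::
  "'a::field \<Rightarrow> nat poly \<Rightarrow> nat \<Rightarrow> (nat \<Rightarrow> nat \<Rightarrow> nat \<Rightarrow> 'a) \<Rightarrow> bool" where
  "change_of_bases q p r T \<longleftrightarrow>
     (\<forall>n\<ge>r. monom 1 (n - r) = (\<Sum>k=r..n. smult (T n k r) (shifted_basis q p r k)))"

text \<open>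
  The recursions below only concern \<open>k > r\<close> and say nothing about the column \<open>k = r\<close>
  beyond its top entry. The last conjunct is the instance \<open>k = r\<close> of the recurrence
  defining \<^const>\<open>qr_stirling2\<close>; without it that column would be arbitrary and
  neither recursion would determine the array.
\<close>

definition boundary_conditions ::
  "'a::field \<Rightarrow> nat poly \<Rightarrow> nat \<Rightarrow> (nat \<Rightarrow> nat \<Rightarrow> nat \<Rightarrow> 'a) \<Rightarrow> bool" where
  "boundary_conditions q p r T \<longleftrightarrow>
     T r r r = 1 \<and>
     (\<forall>n k. k < r \<or> k > n \<or> n < r \<longrightarrow> T n k r = 0) \<and>
     (\<forall>n>r. T n r r = q_num q (poly p r) * T (n - 1) r r)"

definition recursion ::
  "'a::field \<Rightarrow> nat poly \<Rightarrow> nat \<Rightarrow> (nat \<Rightarrow> nat \<Rightarrow> nat \<Rightarrow> 'a) \<Rightarrow> bool" where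
  "recursion q p r T \<longleftrightarrow>
     (\<forall>n k. r < k \<and> k \<le> n \<longrightarrow>
        T n k r = T (n - 1) (k - 1) r + q_num q (poly p k) * T (n - 1) k r) \<and>
     boundary_conditions q p r T"

definition complete_recursion ::
  "'a::field \<Rightarrow> nat poly \<Rightarrow> nat \<Rightarrow> (nat \<Rightarrow> nat \<Rightarrow> nat \<Rightarrow> 'a) \<Rightarrow> bool" where
  "complete_recursion q p r T \<longleftrightarrow>
     (\<forall>n k. r < k \<and> k \<le> n \<longrightarrow>
        T n k r = (\<Sum>j=k..n. T (j - 1) (k - 1) r * q_num q (poly p k) ^ (n - j))) \<and>
     boundary_conditions q p r T"

definition generating_function ::
  "'a::field \<Rightarrow> nat poly \<Rightarrow> nat \<Rightarrow> (nat \<Rightarrow> nat \<Rightarrow> nat \<Rightarrow> 'a) \<Rightarrow> bool" where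
  "generating_function q p r T \<longleftrightarrow>
     (\<forall>k\<ge>r. Abs_fps (\<lambda>n. if k \<le> n then T n k r else 0) =
        fps_X ^ k / (\<Prod>i=r..k. 1 - fps_const (q_num q (poly p i)) * fps_X))"

definition explicit_formula ::
  "'a::field \<Rightarrow> nat poly \<Rightarrow> nat \<Rightarrow> (nat \<Rightarrow> nat \<Rightarrow> nat \<Rightarrow> 'a) \<Rightarrow> bool" where
  "explicit_formula q p r T \<longleftrightarrow>
     (\<forall>n k. r \<le> k \<and> k \<le> n \<longrightarrow>
        T n k r =
          (\<Sum>i \<in> {i \<in> {r..k} \<rightarrow>\<^sub>E (UNIV :: nat set). (\<Sum>l=r..k. i l) = n - k}.
             \<Prod>l=r..k. q_num q (poly p l) ^ i l))"

end

theory Submission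
  imports Defs
begin

text \<open>
  Write \<open>w\<^sub>k\<close> for the weight \<open>[p(k)]\<^sub>q\<close>. Each of the five conditions determines
  at most one array supported on \<open>r \<le> k \<le> n\<close>, and the numbers \<^const>\<open>qr_stirling2\<close> satisfy all five, so each
  condition is equivalent to being that array.

  \<^item> The recursion and its boundary conditions determine row \<open>n + 1\<close> from row \<open>n\<close>
    (\<open>recursion_unique\<close>). Unrolling the last summand of the recursion down to \<open>n = k\<close>
    gives the complete recursion; conversely, splitting off the summand \<open>j = n\<close> of the complete recursion leaves \<open>w\<^sub>k\<close> times the complete recursion
    for \<open>n - 1\<close> (\<open>complete_recursion_iff_recursion\<close>).

  \<^item> Since \<open>x \<phi>\<^sub>k = \<phi>\<^sub>k\<^sub>+\<^sub>1 + w\<^sub>k \<phi>\<^sub>k\<close>, multiplying the expansion of \<open>x\<^bsup>n-r\<^esup>\<close> by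
    \<open>x\<close> changes its coefficients according to the recursion (\<open>change_of_bases_stirling2\<close>).
    As \<open>\<phi>\<^sub>k\<close> is monic of degree \<open>k - r\<close>, the \<open>\<phi>\<^sub>k\<close> are linearly independent, so the
    coefficients are unique (\<open>shifted_basis_independent\<close>).

  \<^item> For the column series \<open>F\<^sub>k = \<Sum>\<^sub>n S\<^sub>n\<^sub>k x\<^sup>n\<close> the recursion reads
    \<open>(1 - w\<^sub>k x) F\<^sub>k = x F\<^sub>k\<^sub>-\<^sub>1\<close> when \<open>k > r\<close>, while the first column gives
    \<open>(1 - w\<^sub>r x) F\<^sub>r = x\<^sup>r\<close>; iterating yields the generating function
    (\<open>stirling2_column_fps\<close>). The array entries are the coefficients of these series, so the
    generating function determines them at once.

  \<^item> The explicit formula is the coefficient of \<open>x\<^sup>n\<close> in that generating function: the factors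
    are geometric series, and a coefficient of a finite product is a sum over all ways of
    distributing the exponent among the factors (\<open>fps_nth_prod\<close>).
\<close>

section \<open>The recursion\<close>

abbreviation q_weight :: "'a::field \<Rightarrow> nat poly \<Rightarrow> nat \<Rightarrow> 'a" where
  "q_weight q p k \<equiv> q_num q (poly p k)"

lemma stirling2_outside: "k < r \<or> n < k \<or> n < r \<Longrightarrow> qr_stirling2 q p n k r = 0"
  by (subst qr_stirling2.simps) auto

lemma stirling2_corner: "qr_stirling2 q p r r r = 1"
  by (subst qr_stirling2.simps) auto

lemma stirling2_first_column:
  "r \<le> n \<Longrightarrow> qr_stirling2 q p (Suc n) r r = q_weight q p r * qr_stirling2 q p n r r"
  by (subst qr_stirling2.simps) auto

lemma stirling2_rec:
  assumes "r \<le> k" "r \<le> n"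
  shows "qr_stirling2 q p (Suc n) (Suc k) r =
    qr_stirling2 q p n k r + q_weight q p (Suc k) * qr_stirling2 q p n (Suc k) r"
proof (cases "k \<le> n")
  case True
  with assms show ?thesis by (subst qr_stirling2.simps) auto
next
  case False
  then show ?thesis by (simp add: stirling2_outside)
qed

lemma recursion_stirling2: "recursion q p r (qr_stirling2 q p)"
proof -
  have "qr_stirling2 q p n k r =
      qr_stirling2 q p (n - 1) (k - 1) r + q_weight q p k * qr_stirling2 q p (n - 1) k r"
    if "r < k" "k \<le> n" for n k
    using stirling2_rec[of r "k - 1" "n - 1" q p] that by simp
  moreover have "qr_stirling2 q p n r r = q_weight q p r * qr_stirling2 q p (n - 1) r r"
    if "r < n" for n
    using stirling2_first_column[of r "n - 1" q p] that by simp
  ultimately show ?thesis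
    by (auto simp: recursion_def boundary_conditions_def stirling2_outside stirling2_corner)
qed

lemma recursion_unique:
  assumes T: "recursion q p r T" and U: "recursion q p r U"
  shows "T n k r = U n k r"
proof (induction n arbitrary: k)
  case 0
  from T U show ?case
    by (cases "k = 0 \<and> r = 0") (auto simp: recursion_def boundary_conditions_def)
next
  case (Suc n)
  note bT = T[unfolded recursion_def boundary_conditions_def]
  note bU = U[unfolded recursion_def boundary_conditions_def]
  consider "k < r \<or> Suc n < k \<or> Suc n < r" | "k = r" "Suc n = r" | "k = r" "r < Suc n"
    | "r < k" "k \<le> Suc n" by linarith
  then show ?case
  proof cases
    case 1
    then show ?thesis using bT bU by metis
  next
    case 2
    then show ?thesis using bT bU by metis
  next
    case 3
    then show ?thesis using bT bU Suc.IH by (metis diff_Suc_1)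
  next
    case 4
    then show ?thesis using bT bU Suc.IH by (metis diff_Suc_1)
  qed
qed

lemma recursion_iff:
  "recursion q p r T \<longleftrightarrow> (\<forall>n k. T n k r = qr_stirling2 q p n k r)"
proof
  assume "\<forall>n k. T n k r = qr_stirling2 q p n k r"
  then show "recursion q p r T"
    using recursion_stirling2[of q p r] by (simp add: recursion_def boundary_conditions_def)
qed (use recursion_unique recursion_stirling2 in blast)

text \<open>
  Let \<open>C n k\<close> be the sum in the complete recursion. Passing from \<open>n\<close> to \<open>n + 1\<close> raises
  every power of the weight by one and adds the summand \<open>T n (k - 1)\<close>, so \<open>C\<close> obeys the
  simple recursion with \<open>T n (k - 1)\<close> as inhomogeneous term. At \<open>n + 1 = k\<close> the remaining sum is empty, which matches
  the boundary value \<open>T n k = 0\<close>.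
\<close>

lemma complete_recursion_iff_recursion:
  "complete_recursion q p r T \<longleftrightarrow> recursion q p r T"
proof -
  define C where "C n k = (\<Sum>j=k..n. T (j - 1) (k - 1) r * q_weight q p k ^ (n - j))" for n k
  have C_Suc: "C (Suc n) k = T n (k - 1) r + q_weight q p k * C n k" if "k \<le> Suc n" for n k
  proof -
    have "(\<Sum>j=k..n. T (j - 1) (k - 1) r * q_weight q p k ^ (Suc n - j)) =
        q_weight q p k * C n k"
      unfolding C_def sum_distrib_left by (intro sum.cong) (auto simp: Suc_diff_le)
    with that show ?thesis by (simp add: C_def)
  qed
  have C_empty: "C n k = 0" if "n < k" for n k
    using that by (simp add: C_def)
  show ?thesis
  proof
    assume *: "complete_recursion q p r T"
    then have bc: "boundary_conditions q p r T" by (simp add: complete_recursion_def)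
    have TC: "T n k r = C n k" if "r < k" "k \<le> n" for n k
      using * that unfolding complete_recursion_def C_def by blast
    have "T n k r = T (n - 1) (k - 1) r + q_weight q p k * T (n - 1) k r"
      if "r < k" "k \<le> n" for n k
    proof -
      have "T (n - 1) k r = C (n - 1) k"
      proof (cases "k \<le> n - 1")
        case True
        then show ?thesis using TC that by simp
      next
        case False
        then show ?thesis using bc C_empty by (simp add: boundary_conditions_def)
      qed
      then show ?thesis using C_Suc[of k "n - 1"] TC that by simp
    qed
    with bc show "recursion q p r T" by (simp add: recursion_def)
  next
    assume *: "recursion q p r T"
    then have bc: "boundary_conditions q p r T" by (simp add: recursion_def)
    have "T n k r = C n k" if "r < k" for n k
    proof (induction n)
      case 0
      then show ?case using that bc C_empty by (simp add: boundary_conditions_def)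
    next
      case (Suc n)
      show ?case
      proof (cases "k \<le> Suc n")
        case True
        then have "T (Suc n) k r = T n (k - 1) r + q_weight q p k * T n k r"
          using * that unfolding recursion_def by (metis diff_Suc_1)
        then show ?thesis using C_Suc[OF True] Suc.IH by simp
      next
        case False
        then show ?thesis using bc C_empty by (simp add: boundary_conditions_def)
      qed
    qed
    then show "complete_recursion q p r T"
      using bc by (simp add: complete_recursion_def C_def)
  qed
qed

section \<open>Change of bases\<close>

lemma shifted_basis_start: "shifted_basis q p r r = 1"
  by (simp add: shifted_basis_def)

lemma shifted_basis_Suc:
  "r \<le> k \<Longrightarrow>
    shifted_basis q p r (Suc k) = shifted_basis q p r k * [:- q_weight q p k, 1:]"
  by (simp add: shifted_basis_def)

lemma monom_mult_shifted_basis: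
  assumes "r \<le> k"
  shows "monom 1 1 * shifted_basis q p r k =
    shifted_basis q p r (Suc k) + smult (q_weight q p k) (shifted_basis q p r k)"
proof -
  have "monom 1 1 = [:- q_weight q p k, 1:] + [:q_weight q p k:]"
    by (simp add: monom_altdef)
  then show ?thesis
    by (simp add: shifted_basis_Suc[OF assms] distrib_right mult.commute)
qed

lemma degree_shifted_basis: "degree (shifted_basis q p r k) = k - r"
  by (simp add: shifted_basis_def degree_prod_eq_sum_degree)

lemma lead_coeff_shifted_basis: "lead_coeff (shifted_basis q p r k) = 1"
  by (simp add: shifted_basis_def lead_coeff_prod)

text \<open>
  The degrees \<open>k - r\<close> are distinct, so the coefficient of \<open>x\<^bsup>n-r\<^esup>\<close> in a combination of
  \<open>\<phi>\<^sub>r, \<dots>, \<phi>\<^sub>n\<close> comes from \<open>\<phi>\<^sub>n\<close> alone; it vanishes, and one descends to \<open>n - 1\<close>.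
\<close>

lemma shifted_basis_independent:
  assumes "r \<le> n" "(\<Sum>k=r..n. smult (c k) (shifted_basis q p r k)) = 0"
  shows "\<forall>k\<in>{r..n}. c k = 0"
  using assms
proof (induction n rule: dec_induct)
  case base
  then show ?case by (simp add: shifted_basis_start)
next
  case (step n)
  let ?\<phi> = "shifted_basis q p r"
  have split: "(\<Sum>k=r..Suc n. smult (c k) (?\<phi> k)) =
      (\<Sum>k=r..n. smult (c k) (?\<phi> k)) + smult (c (Suc n)) (?\<phi> (Suc n))"
    using step.hyps by simp
  have "coeff (?\<phi> k) (Suc n - r) = 0" if "k \<in> {r..n}" for k
    using that by (intro coeff_eq_0) (auto simp: degree_shifted_basis)
  then have "coeff (\<Sum>k=r..n. smult (c k) (?\<phi> k)) (Suc n - r) = 0"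
    by (simp add: coeff_sum)
  moreover have "coeff (?\<phi> (Suc n)) (Suc n - r) = 1"
    using lead_coeff_shifted_basis[of q p r "Suc n"] by (simp add: degree_shifted_basis)
  ultimately have "coeff (\<Sum>k=r..Suc n. smult (c k) (?\<phi> k)) (Suc n - r) = c (Suc n)"
    unfolding split coeff_add coeff_smult by simp
  then have top: "c (Suc n) = 0"
    by (simp only: step.prems coeff_0)
  then have "\<forall>k\<in>{r..n}. c k = 0"
    using step.IH step.prems unfolding split by simp
  with top show ?case by (auto simp: le_Suc_eq)
qed

lemma change_of_bases_stirling2: "change_of_bases q p r (qr_stirling2 q p)"
proof -
  let ?S = "\<lambda>n k. qr_stirling2 q p n k r" and ?\<phi> = "shifted_basis q p r"
    and ?w = "q_weight q p"
  have "monom 1 (n - r) = (\<Sum>k=r..n. smult (?S n k) (?\<phi> k))" if "r \<le> n" for n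
    using that
  proof (induction n rule: dec_induct)
    case base
    then show ?case by (simp add: stirling2_corner shifted_basis_start)
  next
    case (step n)
    have "monom 1 (Suc n - r) = monom 1 1 * (monom 1 (n - r) :: 'a poly)"
      using step.hyps by (simp add: mult_monom Suc_diff_le)
    also have "\<dots> = (\<Sum>k=r..n. smult (?S n k) (monom 1 1 * ?\<phi> k))"
      by (simp add: step.IH sum_distrib_left)
    also have "\<dots> = (\<Sum>k=r..n. smult (?S n k) (?\<phi> (Suc k)))
        + (\<Sum>k=r..n. smult (?w k * ?S n k) (?\<phi> k))"
      unfolding sum.distrib[symmetric]
      by (intro sum.cong refl)
         (auto simp del: One_nat_def
            simp: monom_mult_shifted_basis smult_add_right mult.commute)
    \<comment> \<open>The second sum may run up to \<open>n + 1\<close> because \<open>?S n (n + 1) = 0\<close>. Its term \<open>k = r\<close>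
      is split off because \<open>?\<phi> r\<close> does not occur in the first sum.\<close>
    also have "(\<Sum>k=r..n. smult (?w k * ?S n k) (?\<phi> k)) =
        smult (?w r * ?S n r) (?\<phi> r) +
        (\<Sum>k=r..n. smult (?w (Suc k) * ?S n (Suc k)) (?\<phi> (Suc k)))"
    proof -
      have "(\<Sum>k=r..n. smult (?w k * ?S n k) (?\<phi> k)) =
          (\<Sum>k=r..Suc n. smult (?w k * ?S n k) (?\<phi> k))"
        using step.hyps by (simp add: stirling2_outside)
      also have "\<dots> = smult (?w r * ?S n r) (?\<phi> r) +
          (\<Sum>k=Suc r..Suc n. smult (?w k * ?S n k) (?\<phi> k))"
        using step.hyps by (intro sum.atLeast_Suc_atMost) simp
      finally show ?thesis by (simp only: sum.shift_bounds_cl_Suc_ivl)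
    qed
    also have "(\<Sum>k=r..n. smult (?S n k) (?\<phi> (Suc k))) + (smult (?w r * ?S n r) (?\<phi> r) +
        (\<Sum>k=r..n. smult (?w (Suc k) * ?S n (Suc k)) (?\<phi> (Suc k)))) =
        smult (?S (Suc n) r) (?\<phi> r) + (\<Sum>k=r..n. smult (?S (Suc n) (Suc k)) (?\<phi> (Suc k)))"
      using step.hyps
      by (simp add: stirling2_rec stirling2_first_column smult_add_left sum.distrib)
    also have "\<dots> = smult (?S (Suc n) r) (?\<phi> r) +
        (\<Sum>k=Suc r..Suc n. smult (?S (Suc n) k) (?\<phi> k))"
      by (simp only: sum.shift_bounds_cl_Suc_ivl)
    also have "\<dots> = (\<Sum>k=r..Suc n. smult (?S (Suc n) k) (?\<phi> k))"
      using step.hyps by (intro sum.atLeast_Suc_atMost[symmetric]) simp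
    finally show ?case .
  qed
  then show ?thesis by (simp add: change_of_bases_def)
qed

lemma change_of_bases_unique:
  assumes T: "change_of_bases q p r T" and U: "change_of_bases q p r U"
    and "r \<le> k" "k \<le> n"
  shows "T n k r = U n k r"
proof -
  have "r \<le> n" using assms by simp
  have "(\<Sum>k=r..n. smult (T n k r - U n k r) (shifted_basis q p r k)) =
      monom 1 (n - r) - monom 1 (n - r)"
    using T U \<open>r \<le> n\<close>
    by (simp add: change_of_bases_def smult_diff_left sum_subtractf)
  then have "\<forall>k\<in>{r..n}. T n k r - U n k r = 0"
    by (intro shifted_basis_independent[OF \<open>r \<le> n\<close>]) simp
  with assms show ?thesis by simp
qed

section \<open>Generating function and explicit formula\<close>

lemma stirling2_column_fps:
  assumes "r \<le> k"
  shows "Abs_fps (\<lambda>n. qr_stirling2 q p n k r) *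
    (\<Prod>i=r..k. 1 - fps_const (q_weight q p i) * fps_X) = fps_X ^ k"
  using assms
proof (induction k rule: dec_induct)
  case base
  have "Abs_fps (\<lambda>n. qr_stirling2 q p n r r) =
      fps_X ^ r + fps_X * (fps_const (q_weight q p r) * Abs_fps (\<lambda>n. qr_stirling2 q p n r r))"
    (is "?F = ?R")
  proof (rule fps_ext)
    fix n
    show "fps_nth ?F n = fps_nth ?R n"
    proof (cases n)
      case 0
      then show ?thesis
        by (cases "r = 0") (auto simp: stirling2_corner stirling2_outside)
    next
      case (Suc m)
      consider "r \<le> m" | "r = n" | "n < r" using Suc by linarith
      then show ?thesis
        using Suc by cases (auto simp: stirling2_corner stirling2_outside stirling2_first_column)
    qed
  qed
  then show ?case by (simp add: algebra_simps)
next
  case (step k)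
  let ?F = "\<lambda>k. Abs_fps (\<lambda>n. qr_stirling2 q p n k r)"
  have "?F (Suc k) = fps_X * (?F k + fps_const (q_weight q p (Suc k)) * ?F (Suc k))"
    (is "_ = ?R")
  proof (rule fps_ext)
    fix n
    show "fps_nth (?F (Suc k)) n = fps_nth ?R n"
    proof (cases n)
      case (Suc m)
      with step.hyps show ?thesis
        by (cases "r \<le> m") (auto simp: stirling2_outside stirling2_rec)
    qed (simp add: stirling2_outside)
  qed
  then have "?F (Suc k) * (1 - fps_const (q_weight q p (Suc k)) * fps_X) = fps_X * ?F k"
    by (simp add: algebra_simps)
  then have "?F (Suc k) * (\<Prod>i=r..Suc k. 1 - fps_const (q_weight q p i) * fps_X) =
      fps_X * (?F k * (\<Prod>i=r..k. 1 - fps_const (q_weight q p i) * fps_X))"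
    using step.hyps by (simp add: mult_ac)
  then show ?case by (simp add: step.IH)
qed

lemma prod_one_minus_fps_nonzero:
  "(\<Prod>i\<in>A. 1 - fps_const (c i :: 'a::field) * fps_X) \<noteq> 0"
proof (cases "finite A")
  case True
  have "1 - fps_const (c i) * fps_X \<noteq> 0" for i
  proof
    assume "1 - fps_const (c i) * fps_X = 0"
    then have "fps_nth (1 - fps_const (c i) * fps_X) 0 = 0" by simp
    then show False by simp
  qed
  with True show ?thesis by simp
qed simp

lemma generating_function_stirling2: "generating_function q p r (qr_stirling2 q p)"
proof -
  have "Abs_fps (\<lambda>n. if k \<le> n then qr_stirling2 q p n k r else 0) =
      fps_X ^ k / (\<Prod>i=r..k. 1 - fps_const (q_weight q p i) * fps_X)" if "r \<le> k" for k
  proof -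
    have "Abs_fps (\<lambda>n. if k \<le> n then qr_stirling2 q p n k r else 0) =
        Abs_fps (\<lambda>n. qr_stirling2 q p n k r)"
      by (rule fps_ext) (simp add: stirling2_outside)
    then show ?thesis
      using stirling2_column_fps[OF that, of q p, symmetric]
      by (simp add: prod_one_minus_fps_nonzero)
  qed
  then show ?thesis by (simp add: generating_function_def)
qed

lemma generating_function_unique:
  assumes "generating_function q p r T" "generating_function q p r U" "r \<le> k" "k \<le> n"
  shows "T n k r = U n k r"
proof -
  have "Abs_fps (\<lambda>n. if k \<le> n then T n k r else 0) =
      Abs_fps (\<lambda>n. if k \<le> n then U n k r else 0)"
    using assms by (simp add: generating_function_def)
  from arg_cong[where f = "\<lambda>F. fps_nth F n", OF this] show ?thesis
    using assms(4) by simp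
qed

text \<open>
  Peeling off one factor splits the exponent \<open>n\<close> as \<open>j\<close> for that factor and \<open>n - j\<close> for the
  others; the corresponding operation on exponent functions is \<open>i(a := j)\<close>.
\<close>

lemma fps_nth_prod:
  fixes f :: "'b \<Rightarrow> 'a::comm_ring_1 fps"
  assumes "finite A"
  shows "fps_nth (\<Prod>a\<in>A. f a) n =
    (\<Sum>i\<in>{i \<in> A \<rightarrow>\<^sub>E UNIV. sum i A = n}. \<Prod>a\<in>A. fps_nth (f a) (i a))"
  using assms
proof (induction A arbitrary: n rule: finite_induct)
  case empty
  show ?case by (cases "n = 0") (simp_all add: PiE_empty_domain)
next
  case (insert a A)
  let ?E = "\<lambda>A n. {i \<in> A \<rightarrow>\<^sub>E (UNIV :: nat set). sum i A = n}"
  have fin: "finite (?E A m)" for m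
  proof (rule finite_subset)
    show "?E A m \<subseteq> A \<rightarrow>\<^sub>E {..m}"
    proof
      fix i assume i: "i \<in> ?E A m"
      then have "i b \<le> m" if "b \<in> A" for b
        using member_le_sum[of b A i] that insert.hyps(1) by simp
      with i show "i \<in> A \<rightarrow>\<^sub>E {..m}" by (simp add: PiE_iff)
    qed
  qed (use insert.hyps(1) in \<open>auto intro: finite_PiE\<close>)
  have "fps_nth (\<Prod>a\<in>insert a A. f a) n =
      (\<Sum>j=0..n. fps_nth (f a) j * (\<Sum>i\<in>?E A (n - j). \<Prod>b\<in>A. fps_nth (f b) (i b)))"
    using insert by (simp add: fps_mult_nth)
  also have "\<dots> = (\<Sum>(j, i)\<in>(SIGMA j:{0..n}. ?E A (n - j)).
      fps_nth (f a) j * (\<Prod>b\<in>A. fps_nth (f b) (i b)))"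
    by (simp add: sum_distrib_left sum.Sigma fin)
  also have "\<dots> = (\<Sum>i\<in>?E (insert a A) n. \<Prod>b\<in>insert a A. fps_nth (f b) (i b))"
  proof (rule sum.reindex_bij_witness[where
        i = "\<lambda>i. (i a, i(a := undefined))" and j = "\<lambda>(j, i). i(a := j)"])
    have upd: "sum (i(a := x)) A = sum i A" for i :: "'b \<Rightarrow> nat" and x
      using insert.hyps(2) by (intro sum.cong) auto
    fix s assume s: "s \<in> (SIGMA j:{0..n}. ?E A (n - j))"
    obtain j i where [simp]: "s = (j, i)" by (cases s)
    from s have i: "j \<le> n" "i \<in> A \<rightarrow>\<^sub>E UNIV" "sum i A = n - j" by auto
    show "(\<lambda>i. (i a, i(a := undefined))) ((\<lambda>(j, i). i(a := j)) s) = s"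
      using i insert.hyps by (auto simp: PiE_iff extensional_def)
    show "(\<lambda>(j, i). i(a := j)) s \<in> ?E (insert a A) n"
      using i insert.hyps upd[of i j] by (auto simp: PiE_iff extensional_def)
    have "(\<Prod>b\<in>A. fps_nth (f b) ((i(a := j)) b)) = (\<Prod>b\<in>A. fps_nth (f b) (i b))"
      using insert.hyps(2) by (intro prod.cong) auto
    then show "(\<Prod>b\<in>insert a A. fps_nth (f b) (((\<lambda>(j, i). i(a := j)) s) b)) =
        (case s of (j, i) \<Rightarrow> fps_nth (f a) j * (\<Prod>b\<in>A. fps_nth (f b) (i b)))"
      using insert.hyps by simp
  next
    fix i assume i: "i \<in> ?E (insert a A) n"
    have "sum (i(a := undefined)) A = sum i A"
      using insert.hyps(2) by (intro sum.cong) auto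
    with i show "(\<lambda>i. (i a, i(a := undefined))) i \<in> (SIGMA j:{0..n}. ?E A (n - j))"
      using insert.hyps by (auto simp: PiE_iff extensional_def)
    show "(\<lambda>(j, i). i(a := j)) ((\<lambda>i. (i a, i(a := undefined))) i) = i"
      by simp
  qed
  finally show ?case .
qed

lemma inverse_one_minus_const_fps_X:
  "inverse (1 - fps_const (c :: 'a::field) * fps_X) = Abs_fps (\<lambda>n. c ^ n)"
proof -
  have "(1 - fps_const c * fps_X) * Abs_fps (\<lambda>n. c ^ n) = 1"
  proof (rule fps_ext)
    fix n
    show "fps_nth ((1 - fps_const c * fps_X) * Abs_fps (\<lambda>n. c ^ n)) n = fps_nth 1 n"
      by (cases n) (simp_all add: left_diff_distrib mult.assoc)
  qed
  then show ?thesis by (intro fps_inverse_unique)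
qed

text \<open>
  The factor \<open>x\<^sup>k\<close> of the generating function shifts the coefficients by \<open>k\<close>, which is
  why the exponents add up to \<open>n - k\<close>.
\<close>

lemma explicit_formula_stirling2: "explicit_formula q p r (qr_stirling2 q p)"
  unfolding explicit_formula_def
proof (intro allI impI, elim conjE)
  fix n k assume k: "r \<le> k" "k \<le> n"
  let ?D = "\<Prod>i=r..k. 1 - fps_const (q_weight q p i) * fps_X"
    and ?F = "Abs_fps (\<lambda>n. qr_stirling2 q p n k r)"
  have "(\<Prod>i=r..k. Abs_fps (\<lambda>n. q_weight q p i ^ n)) * ?D =
      (\<Prod>i=r..k. inverse (1 - fps_const (q_weight q p i) * fps_X) *
        (1 - fps_const (q_weight q p i) * fps_X))"
    by (simp add: prod.distrib inverse_one_minus_const_fps_X)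
  also have "\<dots> = 1"
    by (intro prod.neutral ballI inverse_mult_eq_1) simp
  finally have inv: "(\<Prod>i=r..k. Abs_fps (\<lambda>n. q_weight q p i ^ n)) * ?D = 1" .
  have "?F * ?D = (fps_X ^ k * (\<Prod>i=r..k. Abs_fps (\<lambda>n. q_weight q p i ^ n))) * ?D"
    by (simp only: stirling2_column_fps[OF k(1)] mult.assoc inv mult_1_right)
  then have "?F = fps_X ^ k * (\<Prod>i=r..k. Abs_fps (\<lambda>n. q_weight q p i ^ n))"
    by (simp only: mult_right_cancel[OF prod_one_minus_fps_nonzero])
  then have "fps_nth ?F n =
      fps_nth (fps_X ^ k * (\<Prod>i=r..k. Abs_fps (\<lambda>n. q_weight q p i ^ n))) n"
    by simp
  then show "qr_stirling2 q p n k r =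
      (\<Sum>i \<in> {i \<in> {r..k} \<rightarrow>\<^sub>E UNIV. (\<Sum>l=r..k. i l) = n - k}.
        \<Prod>l=r..k. q_weight q p l ^ i l)"
    using k by (simp add: fps_X_power_mult_nth fps_nth_prod)
qed

section \<open>The equivalence\<close>

theorem theorem2p2:
  fixes q :: "'a::field"
    and p :: "nat poly"
    and r :: nat
    and T :: "nat \<Rightarrow> nat \<Rightarrow> nat \<Rightarrow> 'a"
  assumes "\<forall>n k. \<not> (r \<le> k \<and> k \<le> n) \<longrightarrow> T n k r = 0"
  shows "((\<forall>n k. T n k r = qr_stirling2 q p n k r) \<longleftrightarrow> change_of_bases q p r T)
       \<and> ((\<forall>n k. T n k r = qr_stirling2 q p n k r) \<longleftrightarrow> recursion q p r T)
       \<and> ((\<forall>n k. T n k r = qr_stirling2 q p n k r) \<longleftrightarrow> complete_recursion q p r T)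
       \<and> ((\<forall>n k. T n k r = qr_stirling2 q p n k r) \<longleftrightarrow> generating_function q p r T)
       \<and> ((\<forall>n k. T n k r = qr_stirling2 q p n k r) \<longleftrightarrow> explicit_formula q p r T)"
proof -
  let ?eq = "\<forall>n k. T n k r = qr_stirling2 q p n k r"
  have inside: ?eq if "\<And>n k. r \<le> k \<Longrightarrow> k \<le> n \<Longrightarrow> T n k r = qr_stirling2 q p n k r"
  proof (intro allI)
    fix n k
    show "T n k r = qr_stirling2 q p n k r"
    proof (cases "r \<le> k \<and> k \<le> n")
      case False
      with assms have "T n k r = 0" by blast
      with False show ?thesis by (auto simp: stirling2_outside)
    qed (use that in blast)
  qed
  have "?eq \<longleftrightarrow> change_of_bases q p r T"
  proof
    assume ?eq
    with change_of_bases_stirling2[of q p r] show "change_of_bases q p r T"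
      by (simp add: change_of_bases_def)
  qed (use inside change_of_bases_unique change_of_bases_stirling2 in blast)
  moreover have "?eq \<longleftrightarrow> generating_function q p r T"
  proof
    assume ?eq
    with generating_function_stirling2[of q p r] show "generating_function q p r T"
      by (simp add: generating_function_def cong: if_cong)
  qed (use inside generating_function_unique generating_function_stirling2 in blast)
  moreover have "?eq \<longleftrightarrow> explicit_formula q p r T"
  proof
    assume ?eq
    with explicit_formula_stirling2[of q p r] show "explicit_formula q p r T"
      by (simp add: explicit_formula_def)
  next
    assume "explicit_formula q p r T"
    with explicit_formula_stirling2[of q p r] show ?eq
      by (intro inside) (simp add: explicit_formula_def)
  qed
  ultimately show ?thesis
    by (simp add: recursion_iff complete_recursion_iff_recursion)
qed

end
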